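(* Let $\alpha,\lambda,\mu\in\mathbb{C}$ and let $n\ge 1$ be an integer. Then $$\sum_{k=0}^n\binom{n}{k}\mu^k\lambda^{n-k}H_k(\alpha)=\begin{cases}\displaystyle(\mu+\lambda)^n\left(H_n\!\left(\frac{\lambda+\mu\alpha}{\mu+\lambda}\right)-H_n\!\left(\frac{\lambda}{\mu+\lambda}\right)\right), & \text{if }\mu+\lambda\ne 0,\\[3mm] \displaystyle\frac{\lambda^n}{n}\left((1-\alpha)^n-1\right), & \text{if }\mu+\lambda=0.\end{cases}$$
   Context: For $\alpha\in\mathbb{C}$, the generalized harmonic numbers are $H_0(\alpha)=0$ and $H_k(\alpha)=\sum_{j=1}^k\frac{\alpha^j}{j}$ for $k\ge 1$. Convention: $0^0=1$. *)

theory Defs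
  imports Complex_Main
begin

definition gen_harm :: "nat \<Rightarrow> complex \<Rightarrow> complex" where
  "gen_harm k alpha = (\<Sum>j = 1..k. alpha ^ j / of_nat j)"

end

theory Submission
  imports Defs
begin

text \<open>
  Pascal's rule and \<open>H\<^bsub>k+1\<^esub>(\<alpha>) = H\<^sub>k(\<alpha>) + \<alpha>\<^bsup>k+1\<^esup> / (k+1)\<close>, together with the
  absorption identity for binomial coefficients, show that the sums \<open>S\<^sub>n\<close> on the left-hand side
  satisfy \<open>S\<^bsub>n+1\<^esub> = (\<mu> + \<lambda>) S\<^sub>n + ((\<lambda> + \<mu>\<alpha>)\<^bsup>n+1\<^esup> - \<lambda>\<^bsup>n+1\<^esup>) / (n+1)\<close>.
  If \<open>\<mu> + \<lambda> = 0\<close> this is already the closed form; otherwise the recurrence is solved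
  by induction.
\<close>

text \<open>Pascal's rule splits each coefficient in two. The half with lower index
  \<open>k - 1\<close> is reindexed, which costs a factor \<open>x\<close> and turns
  \<open>f k\<close> into \<open>f (Suc k)\<close>.\<close>

lemma binomial_transform_Suc:
  fixes x y :: "'a::comm_ring_1"
  shows "(\<Sum>k\<le>Suc n. of_nat (Suc n choose k) * x ^ k * y ^ (Suc n - k) * f k) =
    y * (\<Sum>k\<le>n. of_nat (n choose k) * x ^ k * y ^ (n - k) * f k) +
    x * (\<Sum>k\<le>n. of_nat (n choose k) * x ^ k * y ^ (n - k) * f (Suc k))"
proof -
  have "y * (\<Sum>k\<le>n. of_nat (n choose k) * x ^ k * y ^ (n - k) * f k) =
      (\<Sum>k\<le>n. of_nat (n choose k) * x ^ k * y ^ (Suc n - k) * f k)"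
    by (auto simp: sum_distrib_left Suc_diff_le algebra_simps intro!: sum.cong)
  \<comment> \<open>The added term vanishes because \<open>n choose Suc n = 0\<close>; now the index
    0 can be split off here exactly as on the left-hand side of the goal.\<close>
  also have "\<dots> = (\<Sum>k\<le>Suc n. of_nat (n choose k) * x ^ k * y ^ (Suc n - k) * f k)"
    by (simp add: binomial_eq_0)
  also have "\<dots> = y ^ Suc n * f 0 +
      (\<Sum>k\<le>n. of_nat (n choose Suc k) * x ^ Suc k * y ^ (n - k) * f (Suc k))"
    by (subst sum.atMost_Suc_shift) simp
  finally have 1: "y * (\<Sum>k\<le>n. of_nat (n choose k) * x ^ k * y ^ (n - k) * f k) = \<dots>" .
  have "(\<Sum>k\<le>Suc n. of_nat (Suc n choose k) * x ^ k * y ^ (Suc n - k) * f k) =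
      y ^ Suc n * f 0 +
      (\<Sum>k\<le>n. of_nat (Suc n choose Suc k) * x ^ Suc k * y ^ (n - k) * f (Suc k))"
    by (subst sum.atMost_Suc_shift) simp
  then show ?thesis
    unfolding 1 by (simp add: sum_distrib_left sum.distrib[symmetric] algebra_simps)
qed

text \<open>Absorption turns the sum into the expansion of \<open>(x + y) ^ Suc n\<close> without
  its term of index 0. It is the integral of \<open>(t + y) ^ n\<close> over t from 0 to
  \<open>x\<close>, done algebraically.\<close>

lemma sum_binomial_divide_Suc:
  fixes x y :: "'a::field_char_0"
  shows "(\<Sum>k\<le>n. of_nat (n choose k) * x ^ Suc k * y ^ (n - k) / of_nat (Suc k)) =
    ((x + y) ^ Suc n - y ^ Suc n) / of_nat (Suc n)"
proof -
  have absorb: "of_nat (n choose k) / of_nat (Suc k) =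
      (of_nat (Suc n choose Suc k) / of_nat (Suc n) :: 'a)" for k
  proof -
    have "of_nat (Suc k) * of_nat (Suc n choose Suc k) = (of_nat (Suc n) * of_nat (n choose k) :: 'a)"
      unfolding of_nat_mult[symmetric] by (simp only: Suc_times_binomial)
    then show ?thesis
      by (simp add: frac_eq_eq mult.commute del: of_nat_Suc binomial_Suc_Suc)
  qed
  have "(x + y) ^ Suc n =
      y ^ Suc n + (\<Sum>k\<le>n. of_nat (Suc n choose Suc k) * x ^ Suc k * y ^ (n - k))"
    unfolding binomial_ring by (subst sum.atMost_Suc_shift) simp
  then have "((x + y) ^ Suc n - y ^ Suc n) / of_nat (Suc n) =
      (\<Sum>k\<le>n. of_nat (Suc n choose Suc k) / of_nat (Suc n) * (x ^ Suc k * y ^ (n - k)))"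
    by (simp add: sum_divide_distrib mult.assoc del: of_nat_Suc binomial_Suc_Suc power_Suc)
  then show ?thesis
    unfolding absorb[symmetric] by (simp add: mult.assoc)
qed

lemma gen_harm_0 [simp]: "gen_harm 0 a = 0"
  by (simp add: gen_harm_def)

lemma gen_harm_Suc: "gen_harm (Suc k) a = gen_harm k a + a ^ Suc k / of_nat (Suc k)"
  by (simp add: gen_harm_def)

lemma binomial_transform_gen_harm_Suc:
  "(\<Sum>k\<le>Suc n. of_nat (Suc n choose k) * mu ^ k * lam ^ (Suc n - k) * gen_harm k alpha) =
    (mu + lam) * (\<Sum>k\<le>n. of_nat (n choose k) * mu ^ k * lam ^ (n - k) * gen_harm k alpha) +
    ((lam + mu * alpha) ^ Suc n - lam ^ Suc n) / of_nat (Suc n)"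
proof -
  \<comment> \<open>The increment of \<open>gen_harm\<close> merges \<open>mu\<close> and
    \<open>alpha\<close> into one power, so the preceding sum formula applies with
    \<open>x = mu * alpha\<close> and \<open>y = lam\<close>.\<close>
  have "mu * (\<Sum>k\<le>n. of_nat (n choose k) * mu ^ k * lam ^ (n - k) * gen_harm (Suc k) alpha) =
      mu * (\<Sum>k\<le>n. of_nat (n choose k) * mu ^ k * lam ^ (n - k) * gen_harm k alpha) +
      (\<Sum>k\<le>n. of_nat (n choose k) * (mu * alpha) ^ Suc k * lam ^ (n - k) / of_nat (Suc k))"
    unfolding sum_distrib_left sum.distrib[symmetric]
    by (rule sum.cong)
       (simp_all add: gen_harm_Suc power_mult_distrib distrib_left mult_ac del: of_nat_Suc)
  then show ?thesis
    unfolding binomial_transform_Suc sum_binomial_divide_Suc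
    by (simp add: distrib_right add_ac del: of_nat_Suc power_Suc)
qed

text \<open>Divided by \<open>(mu + lam) ^ Suc n\<close>, the recurrence telescopes: each step adds
  the next terms of the two harmonic sums.\<close>

lemma binomial_transform_gen_harm:
  assumes "mu + lam \<noteq> 0"
  shows "(\<Sum>k\<le>n. of_nat (n choose k) * mu ^ k * lam ^ (n - k) * gen_harm k alpha) =
    (mu + lam) ^ n *
      (gen_harm n ((lam + mu * alpha) / (mu + lam)) - gen_harm n (lam / (mu + lam)))"
proof (induction n)
  case (Suc n)
  \<comment> \<open>Needed for \<open>z = lam + mu * alpha\<close> and for
    \<open>z = lam\<close>.\<close>
  have "(mu + lam) ^ Suc n * ((z / (mu + lam)) ^ Suc n / of_nat (Suc n)) =
      z ^ Suc n / of_nat (Suc n)" for z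
    using assms by (simp add: power_divide del: of_nat_Suc power_Suc)
  then show ?case
    unfolding binomial_transform_gen_harm_Suc Suc.IH gen_harm_Suc
    by (simp only: power_Suc[of "mu + lam"] right_diff_distrib distrib_left
        diff_divide_distrib mult.assoc) (simp del: of_nat_Suc power_Suc)
qed simp

theorem theorem4p1:
  fixes alpha lam mu :: complex and n :: nat
  assumes "n \<ge> 1"
  shows "(\<Sum>k = 0..n. of_nat (n choose k) * mu ^ k * lam ^ (n - k) * gen_harm k alpha) =
    (if mu + lam \<noteq> 0
     then (mu + lam) ^ n *
       (gen_harm n ((lam + mu * alpha) / (mu + lam)) - gen_harm n (lam / (mu + lam)))
     else lam ^ n / of_nat n * ((1 - alpha) ^ n - 1))"
proof (cases "mu + lam = 0")
  case True
  \<comment> \<open>As \<open>n\<close> is a successor, one use of the recurrence suffices: its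
    factor \<open>mu + lam = 0\<close> removes the earlier sum.\<close>
  obtain m where n: "n = Suc m"
    using assms by (cases n) auto
  have "lam + mu * alpha = lam * (1 - alpha)"
    using True by (simp add: add_eq_0_iff2 algebra_simps)
  then have "(lam + mu * alpha) ^ n = lam ^ n * (1 - alpha) ^ n"
    by (simp add: power_mult_distrib)
  then show ?thesis
    unfolding atMost_atLeast0[symmetric] n binomial_transform_gen_harm_Suc
    using True by (simp add: right_diff_distrib diff_divide_distrib del: of_nat_Suc power_Suc)
next
  case False
  then show ?thesis
    by (simp add: atMost_atLeast0[symmetric] binomial_transform_gen_harm)
qed

end
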